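(* Let $(H;\langle\cdot,\cdot\rangle)$ be an inner product space over the real or complex number field $\mathbb{K}$, let $n\ge2$ be an integer and let $x_i\in H$ for $i\in\{1,\dots,n\}$. Then $$\Big(\sum_{i=1}^n\|x_i\|\Big)^2\le\Big\|\sum_{i=1}^n x_i\Big\|^2+\frac{(n^2-1)n}{6}\sum_{k=1}^{n-1}\|\Delta x_k\|^2.$$ The constant $\frac16$ is best possible: if $H\ne\{0\}$ and $C>0$ is a constant such that $$\Big(\sum_{i=1}^n\|x_i\|\Big)^2\le\Big\|\sum_{i=1}^n x_i\Big\|^2+C\,(n^2-1)n\sum_{k=1}^{n-1}\|\Delta x_k\|^2$$ for all $n\ge2$ and all $x_1,\dots,x_n\in H$, then $C\ge\frac16$.
   Context: $\|\cdot\|$ is the norm induced by the inner product, and $\Delta x_k:=x_{k+1}-x_k$ for $1\le k\le n-1$ denotes the forward difference. *)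

theory Defs
  imports "HOL-Analysis.Inner_Product"
begin

text \<open>
  Real inner product spaces are the library class \<^class>\<open>real_inner\<close>. The class below is its
  complex analogue. The inner product is linear in its first argument. The induced norm gets
  a name of its own because \<^const>\<open>norm\<close> is only available on \<^class>\<open>real_normed_vector\<close>,
  whose axioms (triangle inequality etc.) should not be assumed.
\<close>

class complex_inner = ab_group_add +
  fixes scaleC :: "complex \<Rightarrow> 'a \<Rightarrow> 'a"  (infixr \<open>*\<^sub>C\<close> 75)
    and cinner :: "'a \<Rightarrow> 'a \<Rightarrow> complex"
  assumes scaleC_add_right: "a *\<^sub>C (x + y) = a *\<^sub>C x + a *\<^sub>C y"
    and scaleC_add_left: "(a + b) *\<^sub>C x = a *\<^sub>C x + b *\<^sub>C x"
    and scaleC_scaleC: "a *\<^sub>C b *\<^sub>C x = (a * b) *\<^sub>C x"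
    and scaleC_one: "1 *\<^sub>C x = x"
    and cinner_commute: "cinner x y = cnj (cinner y x)"
    and cinner_add_left: "cinner (x + y) z = cinner x z + cinner y z"
    and cinner_scaleC_left: "cinner (a *\<^sub>C x) y = a * cinner x y"
    and cinner_ge_zero: "cinner x x \<in> \<real> \<and> 0 \<le> Re (cinner x x)"
    and cinner_eq_zero_iff: "cinner x x = 0 \<longleftrightarrow> x = 0"
begin

definition cnorm :: "'a \<Rightarrow> real"
  where "cnorm x = sqrt (Re (cinner x x))"

end

instantiation complex :: complex_inner
begin

definition scaleC_complex :: "complex \<Rightarrow> complex \<Rightarrow> complex"
  where "scaleC_complex a x = a * x"

definition cinner_complex :: "complex \<Rightarrow> complex \<Rightarrow> complex"
  where "cinner_complex x y = x * cnj y"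

instance
  by standard
    (auto simp: scaleC_complex_def cinner_complex_def algebra_simps complex_is_Real_iff)

end

definition forward_diff :: "(nat \<Rightarrow> 'a::minus) \<Rightarrow> nat \<Rightarrow> 'a"  (\<open>\<Delta>\<close>)
  where "\<Delta> x k = x (k + 1) - x k"

end

theory Submission
  imports Defs
begin

text \<open>
  Expanding both squares turns their difference into a sum over pairs:
  \[ \Bigl(\sum_i \|x_i\|\Bigr)^2 - \Bigl\|\sum_i x_i\Bigr\|^2
     = \sum_{i,j} \bigl(\|x_i\|\,\|x_j\| - \mathrm{Re}\langle x_i, x_j\rangle\bigr)
     \le \frac12 \sum_{i,j} \|x_i - x_j\|^2 , \]
  where each term is bounded using $2ab \le a^2 + b^2$. For $i < j$ the vector $x_j - x_i$ is the
  sum of the $j - i$ differences $\Delta x_k$ with $i \le k < j$, so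
  $\|x_j - x_i\|^2 \le (j-i) \sum_{i \le k < j} \|\Delta x_k\|^2$. Exchanging the order of
  summation, $\|\Delta x_k\|^2$ receives the weight
  $\sum_{i \le k < j} (j-i) = \frac12 n k (n-k)$ (lemma \<open>sum_gaps_across\<close>). By
  $k(n-k) \le n^2/4$ this is at most $n^3/8$, which is at most $(n^2-1)n/6$ for
  $n \ge 2$. For $n = 2$ and $x_1 = -h$, $x_2 = h$ equality holds, and this one configuration
  forces $C \ge \frac16$.

  Both arguments make sense for any symmetric, biadditive, positive semidefinite real-valued form
  on an abelian group. They are carried out in that setting, and the real and the complex case are
  the instances $\langle\cdot,\cdot\rangle$ and $\mathrm{Re}\langle\cdot,\cdot\rangle$.
\<close>

section \<open>Positive semidefinite biadditive forms\<close>

locale semidefinite_form =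
  fixes B :: "'a::ab_group_add \<Rightarrow> 'a \<Rightarrow> real"
  assumes commute: "B x y = B y x"
    and add_left: "B (x + y) z = B x z + B y z"
    and nonneg: "0 \<le> B x x"
begin

definition seminorm :: "'a \<Rightarrow> real"
  where "seminorm x = sqrt (B x x)"

lemma seminorm_power2: "(seminorm x)\<^sup>2 = B x x"
  by (simp add: seminorm_def nonneg)

lemma zero_left: "B 0 y = 0"
  using add_left[of 0 0 y] by simp

lemma minus_left: "B (- x) y = - B x y"
  using add_left[of "- x" x y] by (simp add: zero_left)

lemma diff_left: "B (x - y) z = B x z - B y z"
  using add_left[of x "- y" z] by (simp add: minus_left)

lemma minus_right: "B x (- y) = - B x y"
  by (metis commute minus_left)

lemma diff_right: "B x (y - z) = B x y - B x z"
  by (metis commute diff_left)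

lemma sum_left: "B (\<Sum>i\<in>A. f i) y = (\<Sum>i\<in>A. B (f i) y)"
  by (induction A rule: infinite_finite_induct) (auto simp: zero_left add_left)

lemma sum_right: "B x (\<Sum>i\<in>A. f i) = (\<Sum>i\<in>A. B x (f i))"
  by (simp add: commute[of x] sum_left)

lemma diff_diff: "B (x - y) (x - y) = B x x + B y y - 2 * B x y"
  using commute[of x y] by (simp add: diff_left diff_right)

lemma diff_swap: "B (x - y) (x - y) = B (y - x) (y - x)"
  using commute[of x y] by (simp add: diff_diff)

lemma sum_sum: "B (\<Sum>i\<in>A. f i) (\<Sum>i\<in>A. f i) = (\<Sum>i\<in>A. \<Sum>j\<in>A. B (f i) (f j))"
  unfolding sum_left by (simp only: sum_right)

text \<open>
  Summing the polarised bound $2 B(u,v) \le B(u,u) + B(v,v)$ over all pairs takes the place of the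
  usual appeal to the Cauchy--Schwarz inequality.
\<close>

lemma sum_sum_le:
  "B (\<Sum>i\<in>A. f i) (\<Sum>i\<in>A. f i) \<le> real (card A) * (\<Sum>i\<in>A. B (f i) (f i))"
proof -
  have "B (f i) (f j) \<le> (B (f i) (f i) + B (f j) (f j)) / 2" for i j
    using nonneg[of "f i - f j"] by (simp add: diff_diff)
  then have "B (\<Sum>i\<in>A. f i) (\<Sum>i\<in>A. f i)
      \<le> (\<Sum>i\<in>A. \<Sum>j\<in>A. (B (f i) (f i) + B (f j) (f j)) / 2)"
    unfolding sum_sum by (intro sum_mono)
  also have "\<dots> = real (card A) * (\<Sum>i\<in>A. B (f i) (f i))"
    by (simp add: add_divide_distrib sum.distrib sum_distrib_left[symmetric]
        sum_divide_distrib[symmetric])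
  finally show ?thesis .
qed

lemma seminorm_mult_le: "seminorm x * seminorm y \<le> B x y + B (x - y) (x - y) / 2"
proof -
  have "2 * seminorm x * seminorm y \<le> B x x + B y y"
    using sum_squares_bound[of "seminorm x" "seminorm y"] by (simp add: seminorm_power2)
  then show ?thesis
    by (simp add: diff_diff field_simps)
qed

lemma power2_sum_seminorm_le:
  "(\<Sum>i\<in>A. seminorm (x i))\<^sup>2
    \<le> (seminorm (\<Sum>i\<in>A. x i))\<^sup>2 + (\<Sum>i\<in>A. \<Sum>j\<in>A. B (x i - x j) (x i - x j)) / 2"
proof -
  have "(\<Sum>i\<in>A. seminorm (x i))\<^sup>2 = (\<Sum>i\<in>A. \<Sum>j\<in>A. seminorm (x i) * seminorm (x j))"
    by (simp add: power2_eq_square sum_product)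
  also have "\<dots> \<le> (\<Sum>i\<in>A. \<Sum>j\<in>A. B (x i) (x j) + B (x i - x j) (x i - x j) / 2)"
    by (intro sum_mono seminorm_mult_le)
  finally show ?thesis
    by (simp add: seminorm_power2 sum_sum sum.distrib sum_divide_distrib)
qed

end

section \<open>Bounding distances by forward differences\<close>

text \<open>The gap $j - i$ of a pair that is separated by the cut between \<open>k\<close> and \<open>k + 1\<close>.\<close>

definition gap_across :: "nat \<Rightarrow> nat \<Rightarrow> nat \<Rightarrow> real"
  where "gap_across k i j = (if i \<le> k \<and> k < j then real j - real i else 0)"

text \<open>
  A separated pair has \<open>i\<close> among the first \<open>k\<close> indices and \<open>j\<close> among the last \<open>n - k\<close>, so the
  double sum splits into two arithmetic progressions.
\<close>

lemma sum_gaps_across: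
  assumes "k \<le> n"
  shows "(\<Sum>i=1..n. \<Sum>j=1..n. gap_across k i j) = real n * real k * (real n - real k) / 2"
proof -
  have firsts: "(\<Sum>i=1..m. real i) = real m * (real m + 1) / 2" for m
    by (induction m) (simp_all add: field_simps)
  have "(\<Sum>i=1..n. \<Sum>j=1..n. gap_across k i j)
      = (\<Sum>i=1..k. \<Sum>j=Suc k..n. real j - real i)"
  proof -
    have "(\<Sum>j=1..n. gap_across k i j) = (if i \<le> k then \<Sum>j=Suc k..n. real j - real i else 0)"
      for i
    proof (cases "i \<le> k")
      case True
      have "(\<Sum>j=1..n. gap_across k i j) = (\<Sum>j=Suc k..n. gap_across k i j)"
        by (intro sum.mono_neutral_right) (auto simp: gap_across_def)
      also have "\<dots> = (\<Sum>j=Suc k..n. real j - real i)"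
        using True by (intro sum.cong) (auto simp: gap_across_def)
      finally show ?thesis using True by simp
    qed (simp add: gap_across_def)
    moreover have "(\<Sum>i=1..n. if i \<le> k then \<Sum>j=Suc k..n. real j - real i else 0)
        = (\<Sum>i=1..k. \<Sum>j=Suc k..n. real j - real i)"
      using assms by (intro sum.mono_neutral_cong_right) auto
    ultimately show ?thesis by simp
  qed
  also have "\<dots> = real k * (\<Sum>j=Suc k..n. real j) - (real n - real k) * (\<Sum>i=1..k. real i)"
    using assms by (simp add: sum_subtractf sum_distrib_left[symmetric] of_nat_diff)
  also have "(\<Sum>j=Suc k..n. real j) = (\<Sum>j=1..n. real j) - (\<Sum>j=1..k. real j)"
  proof -
    have "{1..n} = {1..k} \<union> {Suc k..n}"
      using assms by auto
    then show ?thesis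
      by (simp add: sum.union_disjoint)
  qed
  finally show ?thesis
    unfolding firsts by (simp add: field_simps)
qed

context semidefinite_form
begin

lemma telescoped_diff_le:
  assumes "i \<le> j"
  shows "B (x j - x i) (x j - x i) \<le> (real j - real i) * (\<Sum>k=i..<j. B (\<Delta> x k) (\<Delta> x k))"
proof -
  have "x j - x i = (\<Sum>k=i..<j. \<Delta> x k)"
    using assms by (simp add: forward_diff_def sum_Suc_diff')
  then show ?thesis
    using sum_sum_le[of "\<Delta> x" "{i..<j}"] assms by (simp add: of_nat_diff)
qed

text \<open>
  The range of \<open>k\<close> no longer depends on \<open>i\<close> and \<open>j\<close>, so that the sums over \<open>k\<close> and over pairs
  can be exchanged. The two weights make the bound symmetric in the pair; at most one of them
  is nonzero.
\<close>

lemma diff_le_gaps_across: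
  assumes "i \<in> {1..n}" "j \<in> {1..n}"
  shows "B (x i - x j) (x i - x j)
    \<le> (\<Sum>k=1..n-1. (gap_across k i j + gap_across k j i) * B (\<Delta> x k) (\<Delta> x k))"
proof -
  have ordered: "B (x j - x i) (x j - x i)
      \<le> (\<Sum>k=1..n-1. (gap_across k i j + gap_across k j i) * B (\<Delta> x k) (\<Delta> x k))"
    if "i \<le> j" "1 \<le> i" "j \<le> n" for i j
  proof -
    have "(real j - real i) * (\<Sum>k=i..<j. B (\<Delta> x k) (\<Delta> x k))
        = (\<Sum>k=1..n-1. (gap_across k i j + gap_across k j i) * B (\<Delta> x k) (\<Delta> x k))"
      unfolding sum_distrib_left
      using that by (intro sum.mono_neutral_cong_left) (auto simp: gap_across_def)
    then show ?thesis
      using telescoped_diff_le[OF \<open>i \<le> j\<close>, of x] by simp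
  qed
  show ?thesis
  proof (cases "i \<le> j")
    case True
    then show ?thesis
      using ordered[of i j] assms diff_swap[of "x i" "x j"] by simp
  next
    case False
    then show ?thesis
      using ordered[of j i] assms by (simp add: add.commute)
  qed
qed

lemma sum_diff_le_weighted_forward_diff:
  "(\<Sum>i=1..n. \<Sum>j=1..n. B (x i - x j) (x i - x j))
    \<le> (\<Sum>k=1..n-1. real n * real k * (real n - real k) * B (\<Delta> x k) (\<Delta> x k))"
proof -
  let ?w = "\<lambda>k. B (\<Delta> x k) (\<Delta> x k)"
  have "(\<Sum>i=1..n. \<Sum>j=1..n. B (x i - x j) (x i - x j))
      \<le> (\<Sum>i=1..n. \<Sum>j=1..n. \<Sum>k=1..n-1. (gap_across k i j + gap_across k j i) * ?w k)"
    by (intro sum_mono diff_le_gaps_across)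
  also have "\<dots> = (\<Sum>i=1..n. \<Sum>k=1..n-1. \<Sum>j=1..n. (gap_across k i j + gap_across k j i) * ?w k)"
    by (intro sum.cong refl sum.swap)
  also have "\<dots> = (\<Sum>k=1..n-1. \<Sum>i=1..n. \<Sum>j=1..n. (gap_across k i j + gap_across k j i) * ?w k)"
    by (rule sum.swap)
  also have "\<dots> = (\<Sum>k=1..n-1. real n * real k * (real n - real k) * ?w k)"
  proof (rule sum.cong[OF refl])
    fix k assume "k \<in> {1..n-1}"
    then have "k \<le> n" by auto
    have "(\<Sum>i=1..n. \<Sum>j=1..n. gap_across k j i) = (\<Sum>i=1..n. \<Sum>j=1..n. gap_across k i j)"
      by (rule sum.swap)
    then have "(\<Sum>i=1..n. \<Sum>j=1..n. gap_across k i j + gap_across k j i)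
        = real n * real k * (real n - real k)"
      unfolding sum.distrib sum_gaps_across[OF \<open>k \<le> n\<close>] by simp
    then show "(\<Sum>i=1..n. \<Sum>j=1..n. (gap_across k i j + gap_across k j i) * ?w k)
        = real n * real k * (real n - real k) * ?w k"
      by (simp only: sum_distrib_right[symmetric])
  qed
  finally show ?thesis .
qed

section \<open>The inequality and its constant\<close>

theorem power2_sum_seminorm_le_forward_diff:
  assumes "n \<ge> 2"
  shows "(\<Sum>i=1..n. seminorm (x i))\<^sup>2
    \<le> (seminorm (\<Sum>i=1..n. x i))\<^sup>2
      + ((real n)\<^sup>2 - 1) * real n / 6 * (\<Sum>k=1..n-1. (seminorm (\<Delta> x k))\<^sup>2)"
proof -
  have weight: "real n * real k * (real n - real k) / 2 \<le> ((real n)\<^sup>2 - 1) * real n / 6" for k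
  proof -
    \<comment> \<open>This is \<open>4 k (n - k) \<le> n\<^sup>2\<close>; equality at \<open>k = n / 2\<close>, the midpoint cut.\<close>
    have "0 \<le> (real n - 2 * real k)\<^sup>2"
      by simp
    moreover have "2\<^sup>2 \<le> (real n)\<^sup>2"
      using assms by (intro power_mono) auto
    ultimately have "3 * (real k * (real n - real k)) \<le> (real n)\<^sup>2 - 1"
      by (simp add: power2_eq_square algebra_simps)
    then have "real n * (3 * (real k * (real n - real k))) \<le> real n * ((real n)\<^sup>2 - 1)"
      by (intro mult_left_mono) auto
    then show ?thesis
      by (simp add: field_simps)
  qed
  have "(\<Sum>i=1..n. \<Sum>j=1..n. B (x i - x j) (x i - x j)) / 2
      \<le> (\<Sum>k=1..n-1. real n * real k * (real n - real k) * B (\<Delta> x k) (\<Delta> x k)) / 2"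
    by (intro divide_right_mono sum_diff_le_weighted_forward_diff) simp
  also have "\<dots> = (\<Sum>k=1..n-1. real n * real k * (real n - real k) / 2 * B (\<Delta> x k) (\<Delta> x k))"
    by (simp add: sum_divide_distrib)
  also have "\<dots> \<le> (\<Sum>k=1..n-1. ((real n)\<^sup>2 - 1) * real n / 6 * B (\<Delta> x k) (\<Delta> x k))"
    by (intro sum_mono mult_right_mono weight nonneg)
  also have "\<dots> = ((real n)\<^sup>2 - 1) * real n / 6 * (\<Sum>k=1..n-1. (seminorm (\<Delta> x k))\<^sup>2)"
    by (simp add: sum_distrib_left seminorm_power2)
  finally show ?thesis
    using power2_sum_seminorm_le[of x "{1..n}"] by simp
qed

text \<open>
  The pair $-h$, $h$ has vanishing sum and difference $2h$, so the inequality reads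
  $4 B(h,h) \le 6 C \cdot 4 B(h,h)$.
\<close>

lemma constant_ge_one_sixth:
  assumes "B h h > 0"
    and ineq: "\<And>(n::nat) (x :: nat \<Rightarrow> 'a). n \<ge> 2 \<Longrightarrow>
      (\<Sum>i=1..n. seminorm (x i))\<^sup>2
        \<le> (seminorm (\<Sum>i=1..n. x i))\<^sup>2
          + C * (((real n)\<^sup>2 - 1) * real n) * (\<Sum>k=1..n-1. (seminorm (\<Delta> x k))\<^sup>2)"
  shows "C \<ge> 1 / 6"
proof -
  define x where "x i = (if i = 1 then - h else h)" for i :: nat
  have interval: "{1..2::nat} = {1, 2}" "{1..2-1::nat} = {1}"
    by auto
  have opposite: "seminorm (- h) = seminorm h"
    by (simp add: seminorm_def minus_left minus_right)
  have "(\<Sum>i=1..2. seminorm (x i))\<^sup>2 = 4 * B h h"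
    unfolding interval by (simp add: x_def opposite power_mult_distrib seminorm_power2)
  moreover have "(seminorm (\<Sum>i=1..2. x i))\<^sup>2 = 0"
    unfolding interval by (simp add: x_def seminorm_def zero_left)
  moreover have "(\<Sum>k=1..2-1. (seminorm (\<Delta> x k))\<^sup>2) = 4 * B h h"
    unfolding interval
    by (simp add: x_def forward_diff_def seminorm_power2 add_left commute[of h "h + h"])
  ultimately have "4 * B h h \<le> C * 6 * (4 * B h h)"
    using ineq[of 2 x] by simp
  then have "0 \<le> (C * 6 - 1) * B h h"
    by (simp add: algebra_simps)
  with \<open>B h h > 0\<close> show ?thesis
    by (simp add: zero_le_mult_iff)
qed

end

section \<open>Real and complex inner product spaces\<close>

interpretation real_form: semidefinite_form "inner :: 'a::real_inner \<Rightarrow> 'a \<Rightarrow> real"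
  by standard (auto simp: inner_commute inner_add_left inner_add_right)

lemma seminorm_inner: "real_form.seminorm = norm"
  by (rule ext) (simp add: real_form.seminorm_def norm_eq_sqrt_inner)

interpretation complex_form:
  semidefinite_form "\<lambda>x y :: 'b::complex_inner. Re (cinner x y)"
proof
  fix x y z :: 'b
  show "Re (cinner x y) = Re (cinner y x)"
    by (subst cinner_commute) simp
qed (use cinner_ge_zero in \<open>auto simp: cinner_add_left\<close>)

lemma seminorm_cinner: "complex_form.seminorm = cnorm"
  by (rule ext) (simp add: complex_form.seminorm_def cnorm_def)

lemma Re_cinner_pos:
  fixes h :: "'b::complex_inner"
  assumes "h \<noteq> 0"
  shows "Re (cinner h h) > 0"
proof -
  have "cinner h h \<noteq> 0"
    using assms by (simp add: cinner_eq_zero_iff)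
  \<comment> \<open>The diagonal is real, so a nonzero value has nonzero real part.\<close>
  then have "Re (cinner h h) \<noteq> 0"
    using cinner_ge_zero[of h] by (auto simp: complex_is_Real_iff complex_eq_iff)
  then show ?thesis
    using cinner_ge_zero[of h] by simp
qed

theorem corollary2:
  shows "((\<forall>(n::nat) (x :: nat \<Rightarrow> 'a::real_inner). n \<ge> 2 \<longrightarrow>
          (\<Sum>i=1..n. norm (x i))\<^sup>2
            \<le> (norm (\<Sum>i=1..n. x i))\<^sup>2
              + ((real n)\<^sup>2 - 1) * real n / 6 * (\<Sum>k=1..n-1. (norm (\<Delta> x k))\<^sup>2))
      \<and> ((\<exists>h::'a::real_inner. h \<noteq> 0) \<longrightarrow>
          (\<forall>C::real. C > 0 \<longrightarrow>
            (\<forall>(n::nat) (x :: nat \<Rightarrow> 'a::real_inner). n \<ge> 2 \<longrightarrow>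
              (\<Sum>i=1..n. norm (x i))\<^sup>2
                \<le> (norm (\<Sum>i=1..n. x i))\<^sup>2
                  + C * (((real n)\<^sup>2 - 1) * real n) * (\<Sum>k=1..n-1. (norm (\<Delta> x k))\<^sup>2))
            \<longrightarrow> C \<ge> 1 / 6)))
   \<and> ((\<forall>(n::nat) (x :: nat \<Rightarrow> 'b::complex_inner). n \<ge> 2 \<longrightarrow>
          (\<Sum>i=1..n. cnorm (x i))\<^sup>2
            \<le> (cnorm (\<Sum>i=1..n. x i))\<^sup>2
              + ((real n)\<^sup>2 - 1) * real n / 6 * (\<Sum>k=1..n-1. (cnorm (\<Delta> x k))\<^sup>2))
      \<and> ((\<exists>h::'b::complex_inner. h \<noteq> 0) \<longrightarrow>
          (\<forall>C::real. C > 0 \<longrightarrow>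
            (\<forall>(n::nat) (x :: nat \<Rightarrow> 'b::complex_inner). n \<ge> 2 \<longrightarrow>
              (\<Sum>i=1..n. cnorm (x i))\<^sup>2
                \<le> (cnorm (\<Sum>i=1..n. x i))\<^sup>2
                  + C * (((real n)\<^sup>2 - 1) * real n) * (\<Sum>k=1..n-1. (cnorm (\<Delta> x k))\<^sup>2))
            \<longrightarrow> C \<ge> 1 / 6)))"
proof (intro conjI; (intro allI impI)?)
  fix n :: nat and x :: "nat \<Rightarrow> 'a"
  assume "n \<ge> 2"
  then show "(\<Sum>i=1..n. norm (x i))\<^sup>2
      \<le> (norm (\<Sum>i=1..n. x i))\<^sup>2
        + ((real n)\<^sup>2 - 1) * real n / 6 * (\<Sum>k=1..n-1. (norm (\<Delta> x k))\<^sup>2)"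
    by (rule real_form.power2_sum_seminorm_le_forward_diff[unfolded seminorm_inner])
next
  fix C :: real
  assume "\<exists>h::'a. h \<noteq> 0"
    and ineq: "\<forall>(n::nat) (x :: nat \<Rightarrow> 'a). n \<ge> 2 \<longrightarrow>
      (\<Sum>i=1..n. norm (x i))\<^sup>2
        \<le> (norm (\<Sum>i=1..n. x i))\<^sup>2
          + C * (((real n)\<^sup>2 - 1) * real n) * (\<Sum>k=1..n-1. (norm (\<Delta> x k))\<^sup>2)"
  then obtain h :: 'a where "inner h h > 0"
    by auto
  then show "C \<ge> 1 / 6"
    by (rule real_form.constant_ge_one_sixth[unfolded seminorm_inner]) (use ineq in blast)
next
  fix n :: nat and x :: "nat \<Rightarrow> 'b"
  assume "n \<ge> 2"
  then show "(\<Sum>i=1..n. cnorm (x i))\<^sup>2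
      \<le> (cnorm (\<Sum>i=1..n. x i))\<^sup>2
        + ((real n)\<^sup>2 - 1) * real n / 6 * (\<Sum>k=1..n-1. (cnorm (\<Delta> x k))\<^sup>2)"
    by (rule complex_form.power2_sum_seminorm_le_forward_diff[unfolded seminorm_cinner])
next
  fix C :: real
  assume "\<exists>h::'b. h \<noteq> 0"
    and ineq: "\<forall>(n::nat) (x :: nat \<Rightarrow> 'b). n \<ge> 2 \<longrightarrow>
      (\<Sum>i=1..n. cnorm (x i))\<^sup>2
        \<le> (cnorm (\<Sum>i=1..n. x i))\<^sup>2
          + C * (((real n)\<^sup>2 - 1) * real n) * (\<Sum>k=1..n-1. (cnorm (\<Delta> x k))\<^sup>2)"
  then obtain h :: 'b where "Re (cinner h h) > 0"
    using Re_cinner_pos by blast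
  then show "C \<ge> 1 / 6"
    by (rule complex_form.constant_ge_one_sixth[unfolded seminorm_cinner]) (use ineq in blast)
qed

end
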